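(* Let $\mathcal D_h$ be the discrete one-step backward operator defined in the context. For fixed $w_c\in\Gamma_h$ and any bounded data sets $\{v_{l,d,c}^{m+1,-}\}_{l,d}$ and $\{z_{l,d,c}^{m+1,-}\}_{l,d}$ on the grid $\Omega^h$ with $\{v_{l,d,c}^{m+1,-}\}_{l,d}\le\{z_{l,d,c}^{m+1,-}\}_{l,d}$ (componentwise), the discrete operator satisfies $$\mathcal D_h\big(\widehat x_{k,j,c}^{m,-},\{v_{l,d,c}^{m+1,-}\}_{l,d}\big)\le\mathcal D_h\big(\widehat x_{k,j,c}^{m,-},\{z_{l,d,c}^{m+1,-}\}_{l,d}\big)\qquad\forall\,(k,j),\ m=M-1,\dots,0,$$ where $\widehat x_{k,j,c}^{m,-}=(s_k,b_j,w_c,t_m^-)$.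
   Context: **Model.** $T>0$, $M\in\mathbb N$, $\Delta t=T/M$, $t_m=m\Delta t$. $g:\mathbb R^2\to[0,\infty)$ is the probability density of a one-step increment $\Delta X$ over $\Delta t$, with characteristic function $G(\eta)=\int_{\mathbb R^2}e^{i\eta\cdot y}g(y)\,dy$; also $G(-ia)=\mathbb E[e^{a\cdot\Delta X}]$ for $a\in\mathbb R^2$ when finite. Standing assumptions: $g\in L_1\cap L_\infty(\mathbb R^2)$; there are $\alpha'\in(0,2]$, $c_0>0$, $R_{\rm tail}\ge0$ with $|G(\eta)|\le\exp(-c_0\Delta t\|\eta\|_2^{\alpha'})$ for $\|\eta\|_2\ge R_{\rm tail}$; $G(-i,0)$, $G(0,-i)$, $G(-i,-i)$ are finite and $G(0,0)=1$. **Domain and data.** Deterministic inputs $q_m\ge0$, a floor parameter $w_{-\infty}\ll0$, $w_{\max}>0$. Let $s_{\min}<0<s_{\max}$, $b_{\min}<0<b_{\max}$, and for $z\in\{s,b\}$ put $z_{\min}^\dagger=z_{\min}-\frac12(z_{\max}-z_{\min})$, $z_{\max}^\dagger=z_{\max}+\frac12(z_{\max}-z_{\min})$. $\Omega=[s_{\min}^\dagger,s_{\max}^\dagger]\times[b_{\min}^\dagger,b_{\max}^\dagger]$, $\Omega_{\rm in}=(s_{\min},s_{\max})\times(b_{\min},b_{\max})$, $\Omega_{s_{\max}}=[s_{\max},s_{\max}^\dagger]\times[b_{\min}^\dagger,b_{\max})$, $\Omega_{b_{\max}}=[s_{\min}^\dagger,s_{\max})\times[b_{\max},b_{\max}^\dagger]$,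 $\Omega_{s_{\max}}^{b_{\max}}=[s_{\max},s_{\max}^\dagger]\times[b_{\max},b_{\max}^\dagger]$, $\Omega_{s_{\min}}^{b_{\min}}$ = the rest of $\Omega$, $\Omega_{\rm out}=\Omega\setminus\Omega_{\rm in}$. For $x\in\Omega_{\rm out}$: $a(x)=(1,0)$ on $\Omega_{s_{\max}}$, $(0,1)$ on $\Omega_{b_{\max}}$, $(1,1)$ on $\Omega_{s_{\max}}^{b_{\max}}$, $(0,0)$ on $\Omega_{s_{\min}}^{b_{\min}}$. $x^+(x,q,u)=\big(\ln\max\{u(e^s+e^b+q),e^{w_{-\infty}}\},\ \ln\max\{(1-u)(e^s+e^b+q),e^{w_{-\infty}}\}\big)$ for $x=(s,b)$; all post-intervention states at which functions on $\Omega$ are evaluated are taken to lie in $\Omega$. **Learned kernel.** Fix $\overline\mu,\sigma_{\max}<\infty$, $\sigma_{\min}>0$, $0<\overline\rho<1$. $\Theta$ is the set of $\theta=\{(\beta_n,\mu_n^s,\mu_n^b,\sigma_n^s,\sigma_n^b,\rho_n)\}_{n=1}^N$ with $\beta_n\ge0$, $\sum_n\beta_n=1$, $|\mu_n^s|,|\mu_n^b|\le\overline\mu$, $\sigma_{\min}\le\sigma_n^s,\sigma_n^b\le\sigma_{\max}$, $|\rho_n|\le\overline\rho$. $\widehat g(y;\theta)=\sum_n\beta_n\phi(y;\mu_n,\Sigma_n)$, with $\phi(\cdot;\mu,\Sigma)$ the bivariate normal density, $\mu_n=(\mu_n^s,\mu_n^b)$ and $\Sigma_n$ the covariance matrix with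 standard deviations $\sigma_n^s,\sigma_n^b$ and correlation $\rho_n$; its characteristic function is $\widehat G(\eta;\theta)=\sum_n\beta_n\exp(i\eta^\top\mu_n-\frac12\eta^\top\Sigma_n\eta)$. Given frequency nodes $\{\eta_p\}_{p=1}^P\subset\mathbb R^2$, $\widehat\theta^\star$ is a minimizer over an empirical set $\widehat\Theta\subset\Theta$ of $\frac1P\sum_p\big(|\Delta_\theta(\eta_p)|^2+|\mathrm{Re}\,\Delta_\theta(\eta_p)|+|\mathrm{Im}\,\Delta_\theta(\eta_p)|\big)$, $\Delta_\theta=G-\widehat G(\cdot;\theta)$. Write $\widehat g(\cdot)=\widehat g(\cdot;\widehat\theta^\star)$. **Grids.** For $z\in\{s,b\}$, $N_z$ is even, $\Delta z=(z_{\max}-z_{\min})/N_z$, nodes $s_k=\frac12(s_{\min}^\dagger+s_{\max}^\dagger)+k\Delta s$, $b_j=\frac12(b_{\min}^\dagger+b_{\max}^\dagger)+j\Delta b$, $k\in\mathbb N_s^\dagger=\{-N_s,\dots,N_s\}$, $j\in\mathbb N_b^\dagger=\{-N_b,\dots,N_b\}$; this grid is $\Omega^h$, and $\Omega_{\rm in}^h,\Omega_{\rm out}^h$ are its nodes in $\Omega_{\rm in},\Omega_{\rm out}$. $\mathcal Z_h$ and $\Gamma_h$ are uniform grids of $[0,1]$ and $[0,w_{\max}]$. $\varphi_{l,d}$ are the composite trapezoidal weights ($1$ interior, $\frac12$ edges, $\frac14$ corners of the grid $\Omega^h$), and $\mathcal I[\cdot]$ is bilinear interpolation on $\Omega$ of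 nodal values on $\Omega^h$. **Discrete operator** ($m<M$). For nodal data $\{F_{l,d}\}$ on $\Omega^h$ let $F^+_{k,j}=\Delta s\Delta b\sum_{l\in\mathbb N_s^\dagger}\sum_{d\in\mathbb N_b^\dagger}\varphi_{l,d}\,\widehat g(s_l-s_k,b_d-b_j)F_{l,d}$ on $\Omega_{\rm in}^h$ and $F^+_{k,j}=G(-i\,a(s_k,b_j))F_{k,j}$ on $\Omega_{\rm out}^h$. Then $\mathcal D_h(\widehat x_{k,j,c}^{m,-},\{F_{l,d}\})=\max_{u\in\mathcal Z_h}\mathcal I[\{F^+\}](x^+((s_k,b_j),q_m,u))$ if $(s_k,b_j)\in\Omega_{\rm in}^h$ and $=G(-i\,a(s_k,b_j))F_{k,j}$ if $(s_k,b_j)\in\Omega_{\rm out}^h$. *)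

theory Defs
  imports "HOL-Analysis.Analysis"
begin

section \<open>Input data\<close>

record component =
  wt :: real
  mean_s :: real
  mean_b :: real
  sd_s :: real
  sd_b :: real
  corr :: real

text \<open>
  \<open>dens\<close> is the density \<open>g\<close> of the one-step increment, \<open>cash m\<close> is \<open>q_m\<close>, \<open>w_floor\<close> is \<open>w_{-\<infinity>}\<close>.
  A parameter vector \<open>\<theta>\<close> is the list of its \<open>n_comp\<close> mixture components; \<open>\<eta>_p\<close> is \<open>freq p\<close> for
  \<open>1 \<le> p \<le> n_freq\<close>.  The grids of \<open>[0,1]\<close> and \<open>[0,w_max]\<close> have \<open>n_u\<close> and \<open>n_w\<close> cells.
\<close>

record scheme =
  maturity :: real
  n_steps :: nat
  dens :: "real ^ 2 \<Rightarrow> real"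
  cash :: "nat \<Rightarrow> real"
  w_floor :: real
  w_max :: real
  s_min :: real
  s_max :: real
  b_min :: real
  b_max :: real
  n_comp :: nat
  mu_bar :: real
  sig_min :: real
  sig_max :: real
  rho_bar :: real
  n_freq :: nat
  freq :: "nat \<Rightarrow> real ^ 2"
  Theta_hat :: "component list set"
  theta_star :: "component list"
  n_s :: nat
  n_b :: nat
  n_u :: nat
  n_w :: nat

section \<open>Model\<close>

definition dt :: "scheme \<Rightarrow> real" where
  "dt S = maturity S / real (n_steps S)"

text \<open>The characteristic function is defined at complex arguments so that \<open>G(-\<i>a)\<close> makes sense.\<close>

definition charfn :: "(real ^ 2 \<Rightarrow> real) \<Rightarrow> complex ^ 2 \<Rightarrow> complex" where
  "charfn g \<zeta> =
     (LINT y|lborel. exp (\<i> * (\<Sum>i\<in>UNIV. \<zeta> $ i * of_real (y $ i))) * of_real (g y))"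

definition charfn_real :: "(real ^ 2 \<Rightarrow> real) \<Rightarrow> real ^ 2 \<Rightarrow> complex" where
  "charfn_real g \<eta> = charfn g (\<chi> i. of_real (\<eta> $ i))"

definition exp_moment :: "(real ^ 2 \<Rightarrow> real) \<Rightarrow> real ^ 2 \<Rightarrow> real" where
  "exp_moment g a = (LINT y|lborel. exp (a \<bullet> y) * g y)"

definition exp_moment_finite :: "(real ^ 2 \<Rightarrow> real) \<Rightarrow> real ^ 2 \<Rightarrow> bool" where
  "exp_moment_finite g a \<longleftrightarrow> integrable lborel (\<lambda>y. exp (a \<bullet> y) * g y)"

text \<open>\<open>G(-\<i>a)\<close> is the real number \<open>E[exp(a \<bullet> \<Delta>X)]\<close>, which is what multiplies real grid data below.\<close>

lemma charfn_imaginary: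
  "charfn g (\<chi> i. - \<i> * of_real (a $ i)) = of_real (exp_moment g a)"
proof -
  have "exp (\<i> * (\<Sum>i\<in>UNIV. (\<chi> i. - \<i> * of_real (a $ i)) $ i * of_real (y $ i))) * of_real (g y)
        = (of_real (exp (a \<bullet> y) * g y) :: complex)" for y :: "real ^ 2"
    by (simp add: sum_distrib_left inner_vec_def exp_of_real[symmetric] mult.assoc[symmetric])
  then show ?thesis
    by (simp add: charfn_def exp_moment_def del: of_real_mult)
qed

definition model_assumptions :: "scheme \<Rightarrow> bool" where
  "model_assumptions S \<longleftrightarrow>
     maturity S > 0 \<and> n_steps S > 0 \<and>
     (\<forall>y. dens S y \<ge> 0) \<and> integrable lborel (dens S) \<and> (LINT y|lborel. dens S y) = 1 \<and>
     (\<exists>C. AE y in lborel. \<bar>dens S y\<bar> \<le> C) \<and>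
     (\<exists>\<alpha> c\<^sub>0 R. 0 < \<alpha> \<and> \<alpha> \<le> 2 \<and> c\<^sub>0 > 0 \<and> R \<ge> 0 \<and>
        (\<forall>\<eta>. norm \<eta> \<ge> R \<longrightarrow>
           cmod (charfn_real (dens S) \<eta>) \<le> exp (- c\<^sub>0 * dt S * norm \<eta> powr \<alpha>))) \<and>
     exp_moment_finite (dens S) (vector [1, 0]) \<and>
     exp_moment_finite (dens S) (vector [0, 1]) \<and>
     exp_moment_finite (dens S) (vector [1, 1]) \<and>
     charfn_real (dens S) 0 = 1"

section \<open>Domain\<close>

definition pad_min :: "real \<Rightarrow> real \<Rightarrow> real" where
  "pad_min lo hi = lo - (hi - lo) / 2"

definition pad_max :: "real \<Rightarrow> real \<Rightarrow> real" where
  "pad_max lo hi = hi + (hi - lo) / 2"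

abbreviation s_min_dag :: "scheme \<Rightarrow> real" where
  "s_min_dag S \<equiv> pad_min (s_min S) (s_max S)"
abbreviation s_max_dag :: "scheme \<Rightarrow> real" where
  "s_max_dag S \<equiv> pad_max (s_min S) (s_max S)"
abbreviation b_min_dag :: "scheme \<Rightarrow> real" where
  "b_min_dag S \<equiv> pad_min (b_min S) (b_max S)"
abbreviation b_max_dag :: "scheme \<Rightarrow> real" where
  "b_max_dag S \<equiv> pad_max (b_min S) (b_max S)"

definition rect :: "real set \<Rightarrow> real set \<Rightarrow> (real ^ 2) set" where
  "rect A B = {x. x $ 1 \<in> A \<and> x $ 2 \<in> B}"

definition Omega :: "scheme \<Rightarrow> (real ^ 2) set" where
  "Omega S = rect {s_min_dag S..s_max_dag S} {b_min_dag S..b_max_dag S}"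

definition Omega_in :: "scheme \<Rightarrow> (real ^ 2) set" where
  "Omega_in S = rect {s_min S<..<s_max S} {b_min S<..<b_max S}"

definition Omega_smax :: "scheme \<Rightarrow> (real ^ 2) set" where
  "Omega_smax S = rect {s_max S..s_max_dag S} {b_min_dag S..<b_max S}"

definition Omega_bmax :: "scheme \<Rightarrow> (real ^ 2) set" where
  "Omega_bmax S = rect {s_min_dag S..<s_max S} {b_max S..b_max_dag S}"

definition Omega_smax_bmax :: "scheme \<Rightarrow> (real ^ 2) set" where
  "Omega_smax_bmax S = rect {s_max S..s_max_dag S} {b_max S..b_max_dag S}"

text \<open>Only used on \<open>Omega S - Omega_in S\<close>; the last case is then the remaining region.\<close>

definition boundary_exponent :: "scheme \<Rightarrow> real ^ 2 \<Rightarrow> real ^ 2" where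
  "boundary_exponent S x =
     (if x \<in> Omega_smax S then vector [1, 0]
      else if x \<in> Omega_bmax S then vector [0, 1]
      else if x \<in> Omega_smax_bmax S then vector [1, 1]
      else vector [0, 0])"

definition x_plus :: "scheme \<Rightarrow> real ^ 2 \<Rightarrow> real \<Rightarrow> real \<Rightarrow> real ^ 2" where
  "x_plus S x q u =
     vector [ln (max (u * (exp (x $ 1) + exp (x $ 2) + q)) (exp (w_floor S))),
             ln (max ((1 - u) * (exp (x $ 1) + exp (x $ 2) + q)) (exp (w_floor S)))]"

definition domain_assumptions :: "scheme \<Rightarrow> bool" where
  "domain_assumptions S \<longleftrightarrow>
     (\<forall>m<n_steps S. cash S m \<ge> 0) \<and> w_floor S < 0 \<and> w_max S > 0 \<and>
     s_min S < 0 \<and> 0 < s_max S \<and> b_min S < 0 \<and> 0 < b_max S"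

section \<open>Learned kernel\<close>

definition mean_vec :: "component \<Rightarrow> real ^ 2" where
  "mean_vec c = vector [mean_s c, mean_b c]"

definition cov_mat :: "component \<Rightarrow> real ^ 2 ^ 2" where
  "cov_mat c = vector [vector [(sd_s c)\<^sup>2, corr c * sd_s c * sd_b c],
                       vector [corr c * sd_s c * sd_b c, (sd_b c)\<^sup>2]]"

definition binormal_density :: "real ^ 2 \<Rightarrow> real ^ 2 ^ 2 \<Rightarrow> real ^ 2 \<Rightarrow> real" where
  "binormal_density \<mu> \<Sigma> y =
     1 / (2 * pi * sqrt (det \<Sigma>)) * exp (- ((y - \<mu>) \<bullet> (matrix_inv \<Sigma> *v (y - \<mu>))) / 2)"

definition Theta :: "scheme \<Rightarrow> component list set" where
  "Theta S = {\<theta>. length \<theta> = n_comp S \<and> (\<Sum>c\<leftarrow>\<theta>. wt c) = 1 \<and>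
     (\<forall>c\<in>set \<theta>. wt c \<ge> 0 \<and> \<bar>mean_s c\<bar> \<le> mu_bar S \<and> \<bar>mean_b c\<bar> \<le> mu_bar S \<and>
        sig_min S \<le> sd_s c \<and> sd_s c \<le> sig_max S \<and>
        sig_min S \<le> sd_b c \<and> sd_b c \<le> sig_max S \<and> \<bar>corr c\<bar> \<le> rho_bar S)}"

definition mixture_density :: "component list \<Rightarrow> real ^ 2 \<Rightarrow> real" where
  "mixture_density \<theta> y = (\<Sum>c\<leftarrow>\<theta>. wt c * binormal_density (mean_vec c) (cov_mat c) y)"

definition mixture_charfn :: "component list \<Rightarrow> real ^ 2 \<Rightarrow> complex" where
  "mixture_charfn \<theta> \<eta> =
     (\<Sum>c\<leftarrow>\<theta>. of_real (wt c) *
        exp (\<i> * of_real (\<eta> \<bullet> mean_vec c) - of_real ((\<eta> \<bullet> (cov_mat c *v \<eta>)) / 2)))"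

definition loss :: "scheme \<Rightarrow> component list \<Rightarrow> real" where
  "loss S \<theta> = 1 / real (n_freq S) * (\<Sum>p = 1..n_freq S.
     (let \<Delta> = charfn_real (dens S) (freq S p) - mixture_charfn \<theta> (freq S p)
      in (cmod \<Delta>)\<^sup>2 + \<bar>Re \<Delta>\<bar> + \<bar>Im \<Delta>\<bar>))"

definition kernel_assumptions :: "scheme \<Rightarrow> bool" where
  "kernel_assumptions S \<longleftrightarrow>
     sig_min S > 0 \<and> 0 < rho_bar S \<and> rho_bar S < 1 \<and> n_freq S > 0 \<and>
     Theta_hat S \<subseteq> Theta S \<and>
     is_arg_min (loss S) (\<lambda>\<theta>. \<theta> \<in> Theta_hat S) (theta_star S)"

definition g_hat :: "scheme \<Rightarrow> real ^ 2 \<Rightarrow> real" where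
  "g_hat S = mixture_density (theta_star S)"

section \<open>Grids\<close>

definition ds :: "scheme \<Rightarrow> real" where
  "ds S = (s_max S - s_min S) / real (n_s S)"

definition db :: "scheme \<Rightarrow> real" where
  "db S = (b_max S - b_min S) / real (n_b S)"

definition idx_s :: "scheme \<Rightarrow> int set" where
  "idx_s S = {- int (n_s S)..int (n_s S)}"

definition idx_b :: "scheme \<Rightarrow> int set" where
  "idx_b S = {- int (n_b S)..int (n_b S)}"

definition s_node :: "scheme \<Rightarrow> int \<Rightarrow> real" where
  "s_node S k = (s_min_dag S + s_max_dag S) / 2 + real_of_int k * ds S"

definition b_node :: "scheme \<Rightarrow> int \<Rightarrow> real" where
  "b_node S j = (b_min_dag S + b_max_dag S) / 2 + real_of_int j * db S"

definition node :: "scheme \<Rightarrow> int \<Rightarrow> int \<Rightarrow> real ^ 2" where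
  "node S k j = vector [s_node S k, b_node S j]"

definition Z_h :: "scheme \<Rightarrow> real set" where
  "Z_h S = (\<lambda>i. real i / real (n_u S)) ` {0..n_u S}"

definition Gamma_h :: "scheme \<Rightarrow> real set" where
  "Gamma_h S = (\<lambda>c. real c * w_max S / real (n_w S)) ` {0..n_w S}"

definition grid_assumptions :: "scheme \<Rightarrow> bool" where
  "grid_assumptions S \<longleftrightarrow>
     n_s S > 0 \<and> even (n_s S) \<and> n_b S > 0 \<and> even (n_b S) \<and> n_u S > 0 \<and> n_w S > 0"

text \<open>The states at which the discrete operator interpolates are taken to lie in \<open>\<Omega>\<close>.\<close>

definition states_in_domain :: "scheme \<Rightarrow> bool" where
  "states_in_domain S \<longleftrightarrow>
     (\<forall>m<n_steps S. \<forall>k\<in>idx_s S. \<forall>j\<in>idx_b S. \<forall>u\<in>Z_h S.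
        node S k j \<in> Omega_in S \<longrightarrow> x_plus S (node S k j) (cash S m) u \<in> Omega S)"

definition trap_weight :: "scheme \<Rightarrow> int \<Rightarrow> int \<Rightarrow> real" where
  "trap_weight S l d =
     (if \<bar>l\<bar> = int (n_s S) \<and> \<bar>d\<bar> = int (n_b S) then 1/4
      else if \<bar>l\<bar> = int (n_s S) \<or> \<bar>d\<bar> = int (n_b S) then 1/2
      else 1)"

text \<open>
  Lower left corner of a grid cell containing the point; the \<open>min\<close> assigns the upper edges
  of \<open>\<Omega>\<close> to the last cell, so that all four corners are grid nodes.
\<close>

definition cell_s :: "scheme \<Rightarrow> real \<Rightarrow> int" where
  "cell_s S x = min \<lfloor>(x - s_node S 0) / ds S\<rfloor> (int (n_s S) - 1)"

definition cell_b :: "scheme \<Rightarrow> real \<Rightarrow> int" where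
  "cell_b S x = min \<lfloor>(x - b_node S 0) / db S\<rfloor> (int (n_b S) - 1)"

definition bilinear :: "scheme \<Rightarrow> (int \<Rightarrow> int \<Rightarrow> real) \<Rightarrow> real ^ 2 \<Rightarrow> real" where
  "bilinear S F x =
     (let l = cell_s S (x $ 1); d = cell_b S (x $ 2);
          p = (x $ 1 - s_node S l) / ds S; r = (x $ 2 - b_node S d) / db S
      in (1 - p) * (1 - r) * F l d + p * (1 - r) * F (l + 1) d
         + (1 - p) * r * F l (d + 1) + p * r * F (l + 1) (d + 1))"

section \<open>Discrete operator\<close>

text \<open>Nodal data on \<open>\<Omega>\<^sup>h\<close> are functions of the indices, relevant on \<open>idx_s S \<times> idx_b S\<close> only.\<close>

definition F_plus :: "scheme \<Rightarrow> (int \<Rightarrow> int \<Rightarrow> real) \<Rightarrow> int \<Rightarrow> int \<Rightarrow> real" where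
  "F_plus S F k j =
     (if node S k j \<in> Omega_in S
      then ds S * db S * (\<Sum>l\<in>idx_s S. \<Sum>d\<in>idx_b S.
             trap_weight S l d * g_hat S (node S l d - node S k j) * F l d)
      else exp_moment (dens S) (boundary_exponent S (node S k j)) * F k j)"

text \<open>
  The state \<open>(s_k, b_j, w_c, t_m-)\<close> is represented by \<open>(k, j, w_c, m)\<close>.
  The one-step operator does not depend on the component \<open>w_c\<close>.
\<close>

definition D_h :: "scheme \<Rightarrow> int \<times> int \<times> real \<times> nat \<Rightarrow> (int \<Rightarrow> int \<Rightarrow> real) \<Rightarrow> real" where
  "D_h S = (\<lambda>(k, j, w, m) F.
     if node S k j \<in> Omega_in S
     then Max ((\<lambda>u. bilinear S (F_plus S F) (x_plus S (node S k j) (cash S m) u)) ` Z_h S)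
     else exp_moment (dens S) (boundary_exponent S (node S k j)) * F k j)"

definition bounded_data :: "scheme \<Rightarrow> (int \<Rightarrow> int \<Rightarrow> real) \<Rightarrow> bool" where
  "bounded_data S F \<longleftrightarrow> (\<exists>C. \<forall>l\<in>idx_s S. \<forall>d\<in>idx_b S. \<bar>F l d\<bar> \<le> C)"

end

theory Submission
  imports Defs
begin

text \<open>
  Each ingredient of the operator has nonnegative coefficients in the nodal data: the trapezoidal
  quadrature of a Gaussian mixture, the boundary factor \<open>G(-\<i>a)\<close>, and bilinear interpolation at a
  point of \<open>\<Omega>\<close>, whose weights form a convex combination.  Maxima preserve order.
\<close>

lemma binormal_density_nonneg:
  assumes "det \<Sigma> \<ge> 0"
  shows "binormal_density \<mu> \<Sigma> y \<ge> 0"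
  using assms by (simp add: binormal_density_def)

text \<open>Since \<open>sqrt\<close> is negative on negative arguments, the bound on the correlation is essential.\<close>

lemma det_cov_mat_nonneg:
  assumes "\<bar>corr c\<bar> \<le> 1"
  shows "det (cov_mat c) \<ge> 0"
proof -
  have "det (cov_mat c) = (1 - (corr c)\<^sup>2) * (sd_s c * sd_b c)\<^sup>2"
    by (simp add: cov_mat_def det_2 power2_eq_square algebra_simps)
  moreover have "(corr c)\<^sup>2 \<le> 1"
    using assms by (simp add: abs_square_le_1)
  ultimately show ?thesis by simp
qed

lemma mixture_density_nonneg:
  assumes "\<theta> \<in> Theta S" "rho_bar S < 1"
  shows "mixture_density \<theta> y \<ge> 0"
  unfolding mixture_density_def
proof (rule sum_list_nonneg)
  fix t assume "t \<in> set (map (\<lambda>c. wt c * binormal_density (mean_vec c) (cov_mat c) y) \<theta>)"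
  then obtain c where c: "c \<in> set \<theta>" "t = wt c * binormal_density (mean_vec c) (cov_mat c) y"
    by auto
  have "wt c \<ge> 0" "\<bar>corr c\<bar> \<le> 1"
    using assms c(1) by (force simp: Theta_def)+
  then show "t \<ge> 0"
    using c(2) by (simp add: binormal_density_nonneg det_cov_mat_nonneg)
qed

text \<open>A minimizer is an element of \<open>Theta_hat\<close>, hence of \<open>Theta\<close>, so
  its components obey the weight and correlation bounds.\<close>

lemma g_hat_nonneg:
  assumes "kernel_assumptions S"
  shows "g_hat S y \<ge> 0"
  using assms mixture_density_nonneg
  by (auto simp: g_hat_def kernel_assumptions_def is_arg_min_def)

text \<open>The Bochner integral of a non-integrable function is 0, so nonnegativity of
  \<open>g\<close> settles every exponent \<open>a\<close>.\<close>

lemma exp_moment_nonneg: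
  assumes "\<And>y. g y \<ge> 0"
  shows "exp_moment g a \<ge> 0"
  unfolding exp_moment_def using assms by (intro integral_nonneg_AE) simp

lemma trap_weight_nonneg: "trap_weight S l d \<ge> 0"
  by (simp add: trap_weight_def)

lemma ds_pos:
  assumes "domain_assumptions S" "grid_assumptions S"
  shows "ds S > 0"
  using assms by (auto simp: ds_def domain_assumptions_def grid_assumptions_def)

lemma db_pos:
  assumes "domain_assumptions S" "grid_assumptions S"
  shows "db S > 0"
  using assms by (auto simp: db_def domain_assumptions_def grid_assumptions_def)

text \<open>Both sides take the same branch, since it depends on the node and not on the
  data.\<close>

lemma F_plus_mono:
  assumes "model_assumptions S" "domain_assumptions S" "kernel_assumptions S" "grid_assumptions S"
    and le: "\<And>l d. l \<in> idx_s S \<Longrightarrow> d \<in> idx_b S \<Longrightarrow> v l d \<le> z l d"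
    and "k \<in> idx_s S" "j \<in> idx_b S"
  shows "F_plus S v k j \<le> F_plus S z k j"
proof -
  have "exp_moment (dens S) a \<ge> 0" for a
    using assms(1) by (intro exp_moment_nonneg) (simp add: model_assumptions_def)
  moreover have "ds S * db S \<ge> 0"
    using ds_pos[OF assms(2,4)] db_pos[OF assms(2,4)] by simp
  ultimately show ?thesis
    unfolding F_plus_def using assms
    by (auto intro!: mult_left_mono sum_mono simp: trap_weight_nonneg g_hat_nonneg)
qed

text \<open>
  At the upper end \<open>x = a + n h\<close> the floor is \<open>n\<close>, so the minimum is attained by \<open>n - 1\<close> and the
  local coordinate is \<open>1\<close>.
\<close>

lemma cell_bounds:
  fixes x a h :: real and n :: nat
  assumes "h > 0" "\<bar>x - a\<bar> \<le> real n * h"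
  defines "l \<equiv> min \<lfloor>(x - a) / h\<rfloor> (int n - 1)"
  assumes "n > 0"
  shows "l \<in> {- int n..int n}" "l + 1 \<in> {- int n..int n}"
    "0 \<le> (x - (a + real_of_int l * h)) / h" "(x - (a + real_of_int l * h)) / h \<le> 1"
proof -
  define y where "y = (x - a) / h"
  have y: "- real n \<le> y" "y \<le> real n"
    using assms(1,2) by (auto simp: y_def abs_le_iff field_simps)
  have l: "l = min \<lfloor>y\<rfloor> (int n - 1)"
    by (simp add: l_def y_def)
  have coord: "(x - (a + real_of_int l * h)) / h = y - real_of_int l"
    using assms(1) by (simp add: y_def field_simps)
  have "- int n \<le> \<lfloor>y\<rfloor>"
    using y by (simp add: le_floor_iff)
  \<comment> \<open>The cap gives \<open>l + 1 \<le> n\<close>; \<open>n > 0\<close> gives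
    \<open>- n \<le> n - 1\<close>, so the cap cannot push \<open>l\<close> off the grid.\<close>
  then show "l \<in> {- int n..int n}" "l + 1 \<in> {- int n..int n}"
    using assms(4) by (auto simp: l)
  have "0 \<le> y - real_of_int l" "y - real_of_int l \<le> 1"
    unfolding l using y by linarith+
  then show "0 \<le> (x - (a + real_of_int l * h)) / h" "(x - (a + real_of_int l * h)) / h \<le> 1"
    unfolding coord .
qed

lemma bilinear_mono:
  assumes "domain_assumptions S" "grid_assumptions S" "x \<in> Omega S"
    and le: "\<And>l d. l \<in> idx_s S \<Longrightarrow> d \<in> idx_b S \<Longrightarrow> F l d \<le> H l d"
  shows "bilinear S F x \<le> bilinear S H x"
proof -
  have n: "n_s S > 0" "n_b S > 0"
    using assms(2) by (auto simp: grid_assumptions_def)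
  \<comment> \<open>Padding doubles the width of the interval, so \<open>n_s S\<close> cells reach
    from the centre \<open>s_node S 0\<close> to either padded end.\<close>
  have "real (n_s S) * ds S = s_max S - s_min S"
    using n by (simp add: ds_def)
  then have "\<bar>x $ 1 - s_node S 0\<bar> \<le> real (n_s S) * ds S"
    using assms(3)
    by (simp add: Omega_def rect_def s_node_def pad_min_def pad_max_def abs_le_iff field_simps)
  note s = cell_bounds[OF ds_pos[OF assms(1,2)] this n(1), folded cell_s_def idx_s_def]
  have "real (n_b S) * db S = b_max S - b_min S"
    using n by (simp add: db_def)
  then have "\<bar>x $ 2 - b_node S 0\<bar> \<le> real (n_b S) * db S"
    using assms(3)
    by (simp add: Omega_def rect_def b_node_def pad_min_def pad_max_def abs_le_iff field_simps)
  note b = cell_bounds[OF db_pos[OF assms(1,2)] this n(2), folded cell_b_def idx_b_def]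
  \<comment> \<open>\<open>cell_bounds\<close> states the local coordinate with an explicit offset;
    folding gives the form used in \<open>bilinear\<close>.\<close>
  have "s_node S l = s_node S 0 + real_of_int l * ds S" for l
    by (simp add: s_node_def)
  note s = s[folded this]
  have "b_node S l = b_node S 0 + real_of_int l * db S" for l
    by (simp add: b_node_def)
  note b = b[folded this]
  show ?thesis
    unfolding bilinear_def Let_def
    using s b by (intro add_mono mult_left_mono le mult_nonneg_nonneg) auto
qed

lemma Max_image_mono:
  fixes f g :: "'a \<Rightarrow> 'b :: linorder"
  assumes "finite A" "A \<noteq> {}" "\<And>x. x \<in> A \<Longrightarrow> f x \<le> g x"
  shows "Max (f ` A) \<le> Max (g ` A)"
  using assms by (auto intro: order_trans[OF assms(3)])

theorem lemma6p3:
  fixes S :: scheme and w :: real and v z :: "int \<Rightarrow> int \<Rightarrow> real"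
  assumes "model_assumptions S"
    and "domain_assumptions S"
    and "kernel_assumptions S"
    and "grid_assumptions S"
    and "states_in_domain S"
    and "w \<in> Gamma_h S"
    and "bounded_data S v"
    and "bounded_data S z"
    and "\<forall>l\<in>idx_s S. \<forall>d\<in>idx_b S. v l d \<le> z l d"
  shows "\<forall>m<n_steps S. \<forall>k\<in>idx_s S. \<forall>j\<in>idx_b S. D_h S (k, j, w, m) v \<le> D_h S (k, j, w, m) z"
proof (intro allI ballI impI)
  fix m k j assume mkj: "m < n_steps S" "k \<in> idx_s S" "j \<in> idx_b S"
  \<comment> \<open>An interior state can be sent into a cell with outer corners, so the comparison
    is needed at every node.\<close>
  have le: "F_plus S v l d \<le> F_plus S z l d" if "l \<in> idx_s S" "d \<in> idx_b S" for l d
    using F_plus_mono[OF assms(1-4) _ that] assms(9) by blast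
  show "D_h S (k, j, w, m) v \<le> D_h S (k, j, w, m) z"
  proof (cases "node S k j \<in> Omega_in S")
    case True
    have "bilinear S (F_plus S v) (x_plus S (node S k j) (cash S m) u)
        \<le> bilinear S (F_plus S z) (x_plus S (node S k j) (cash S m) u)" if "u \<in> Z_h S" for u
      using assms(5) mkj that True
      by (intro bilinear_mono[OF assms(2,4)] le) (auto simp: states_in_domain_def)
    moreover have "finite (Z_h S)" "Z_h S \<noteq> {}"
      by (auto simp: Z_h_def)
    ultimately show ?thesis
      \<comment> \<open>Left active, \<open>Max_le_iff\<close> would rewrite the inequality before
        \<open>Max_image_mono\<close> applies.\<close>
      using True by (auto simp: D_h_def simp del: Max_le_iff intro!: Max_image_mono)
  next
    case False
    \<comment> \<open>At an outer node \<open>D_h\<close> equals \<open>F_plus\<close>.\<close>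
    then show ?thesis
      using le[OF mkj(2,3)] by (simp add: D_h_def F_plus_def)
  qed
qed

end
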